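(* Every unipolar formula derivable in $LJ^+$ is also derivable in $LJ$. There exist formulas derivable in $LK$ but not derivable in $LJ^+$.
   Context: Formulas are first-order formulas, in a language without function symbols and without object constants and having propositional symbols and predicate symbols of each arity available, built from propositional symbols (relation symbols of arity $0$), predicate symbols (relation symbols of arity at least $1$), the logical constants $\top,\bot$, the connectives $\&,\lor,\neg,\supset$ and the quantifiers $\forall,\exists$; quantified formulas $\forall x\,F(x)$, $\exists x\,F(x)$ are formed only from $F(x)$ in which $x$ occurs free. $\top,\bot$ are not counted as propositional or predicate symbols. A formula is propositional if it contains only propositional symbols (no predicate symbols). Positive and negative subformula occurrences in a formula $A$ are defined recursively: $A$ itself is positive; if $B\lor C$ or $B\&C$ is positive (negative), then $B$ and $C$ are positive (negative); if $\neg B$ is positive (negative), then $B$ is negative (positive); if $B\supset C$ is positive (negative), then $B$ is negative (positive) and $C$ is positive (negative); if $\forall x\,B(x)$ or $\exists x\,B(x)$ is positive (negative), then $B(x)$ is positive (negative). A formula is unipolar if for every propositional symbol, its occurrences in the formula are either all positive or all negative. A sequent is $\Gamma\vdash\Lambda$ with $\Gamma$ a finite, possibly empty sequence of formulas and $\Lambda$ either a single formula or empty. The calculus $LJ$ (Gentzen's intuitionistic sequent calculus) has axioms $A\vdash A$ (any formula $A$), $\vdash\top$, $\bot\vdash$, and the following rules (premises / conclusion). Thinning: $\Gamma\vdash\Lambda\,/\,A,\Gamma\vdash\Lambda$; $\Gamma\vdash\,/\,\Gamma\vdash A$. Contraction: $A,A,\Gamma\vdash\Lambda\,/\,A,\Gamma\vdash\Lambda$.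 Exchange: $\Pi,A,B,\Gamma\vdash\Lambda\,/\,\Pi,B,A,\Gamma\vdash\Lambda$. Cut: $\Gamma\vdash C$ and $C,\Pi\vdash\Lambda\,/\,\Gamma,\Pi\vdash\Lambda$. $\&$: $\Gamma\vdash A$ and $\Gamma\vdash B\,/\,\Gamma\vdash A\&B$; $A,\Gamma\vdash\Lambda\,/\,A\&B,\Gamma\vdash\Lambda$; $B,\Gamma\vdash\Lambda\,/\,A\&B,\Gamma\vdash\Lambda$. $\lor$: $A,\Gamma\vdash\Lambda$ and $B,\Gamma\vdash\Lambda\,/\,A\lor B,\Gamma\vdash\Lambda$; $\Gamma\vdash A\,/\,\Gamma\vdash A\lor B$; $\Gamma\vdash B\,/\,\Gamma\vdash A\lor B$. $\neg$: $A,\Gamma\vdash\,/\,\Gamma\vdash\neg A$; $\Gamma\vdash A\,/\,\neg A,\Gamma\vdash$. $\supset$: $A,\Gamma\vdash B\,/\,\Gamma\vdash A\supset B$; $\Gamma\vdash A$ and $B,\Pi\vdash\Lambda\,/\,A\supset B,\Gamma,\Pi\vdash\Lambda$. $\forall$: $\Gamma\vdash F(a)\,/\,\Gamma\vdash\forall x\,F(x)$; $F(a),\Gamma\vdash\Lambda\,/\,\forall x\,F(x),\Gamma\vdash\Lambda$. $\exists$: $\Gamma\vdash F(a)\,/\,\Gamma\vdash\exists x\,F(x)$; $F(a),\Gamma\vdash\Lambda\,/\,\exists x\,F(x),\Gamma\vdash\Lambda$. Here $a$ is a variable and $F(a)$ is the result of (capture-free) substitution of $a$ for $x$ in $F(x)$;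 in the $\forall$-succedent and $\exists$-antecedent rules $a$ (the eigenvariable) must not occur in the conclusion. $LJ^+$ is $LJ$ extended with the neutralization rule: $N,\Gamma\vdash\Lambda$ and $\neg N,\Gamma\vdash\Lambda\,/\,\Gamma\vdash\Lambda$, where $N$ must be a propositional formula. $LK$ (classical logic) is $LJ$ plus the axiom schema $\vdash A\lor\neg A$ for every formula $A$. A formula $A$ is derivable in a calculus if the sequent $\vdash A$ is. *)

theory Defs
  imports Main
begin

(* A relation symbol is a name together with an arity, the arity being read off
   the argument list: every type 'r of names supplies symbols of each arity, and
   Atom p [] is a propositional symbol.  The only terms are variables. *)
datatype 'r form =
    Atom 'r "nat list"
  | Top
  | Bot
  | And "'r form" "'r form"
  | Or "'r form" "'r form"
  | Neg "'r form"
  | Imp "'r form" "'r form"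
  | Forall nat "'r form"
  | Exists nat "'r form"

fun free_vars :: "'r form \<Rightarrow> nat set" where
  "free_vars (Atom r xs) = set xs"
| "free_vars Top = {}"
| "free_vars Bot = {}"
| "free_vars (And A B) = free_vars A \<union> free_vars B"
| "free_vars (Or A B) = free_vars A \<union> free_vars B"
| "free_vars (Neg A) = free_vars A"
| "free_vars (Imp A B) = free_vars A \<union> free_vars B"
| "free_vars (Forall x A) = free_vars A - {x}"
| "free_vars (Exists x A) = free_vars A - {x}"

(* All variables occurring in a formula, free or bound. *)
fun all_vars :: "'r form \<Rightarrow> nat set" where
  "all_vars (Atom r xs) = set xs"
| "all_vars Top = {}"
| "all_vars Bot = {}"
| "all_vars (And A B) = all_vars A \<union> all_vars B"
| "all_vars (Or A B) = all_vars A \<union> all_vars B"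
| "all_vars (Neg A) = all_vars A"
| "all_vars (Imp A B) = all_vars A \<union> all_vars B"
| "all_vars (Forall x A) = insert x (all_vars A)"
| "all_vars (Exists x A) = insert x (all_vars A)"

(* Elements of the type 'r form are formulas only if they contain no vacuous
   quantification. *)
fun is_formula :: "'r form \<Rightarrow> bool" where
  "is_formula (Atom r xs) = True"
| "is_formula Top = True"
| "is_formula Bot = True"
| "is_formula (And A B) = (is_formula A \<and> is_formula B)"
| "is_formula (Or A B) = (is_formula A \<and> is_formula B)"
| "is_formula (Neg A) = is_formula A"
| "is_formula (Imp A B) = (is_formula A \<and> is_formula B)"
| "is_formula (Forall x A) = (x \<in> free_vars A \<and> is_formula A)"
| "is_formula (Exists x A) = (x \<in> free_vars A \<and> is_formula A)"

(* subst x a F replaces the free occurrences of x in F by a, without renaming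
   bound variables; it is capture-free exactly when free_for x a F holds. *)
fun subst :: "nat \<Rightarrow> nat \<Rightarrow> 'r form \<Rightarrow> 'r form" where
  "subst x a (Atom r xs) = Atom r (map (\<lambda>y. if y = x then a else y) xs)"
| "subst x a Top = Top"
| "subst x a Bot = Bot"
| "subst x a (And A B) = And (subst x a A) (subst x a B)"
| "subst x a (Or A B) = Or (subst x a A) (subst x a B)"
| "subst x a (Neg A) = Neg (subst x a A)"
| "subst x a (Imp A B) = Imp (subst x a A) (subst x a B)"
| "subst x a (Forall y A) = (if y = x then Forall y A else Forall y (subst x a A))"
| "subst x a (Exists y A) = (if y = x then Exists y A else Exists y (subst x a A))"

fun free_for :: "nat \<Rightarrow> nat \<Rightarrow> 'r form \<Rightarrow> bool" where
  "free_for x a (Atom r xs) = True"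
| "free_for x a Top = True"
| "free_for x a Bot = True"
| "free_for x a (And A B) = (free_for x a A \<and> free_for x a B)"
| "free_for x a (Or A B) = (free_for x a A \<and> free_for x a B)"
| "free_for x a (Neg A) = free_for x a A"
| "free_for x a (Imp A B) = (free_for x a A \<and> free_for x a B)"
| "free_for x a (Forall y A) = (x \<in> free_vars (Forall y A) \<longrightarrow> y \<noteq> a \<and> free_for x a A)"
| "free_for x a (Exists y A) = (x \<in> free_vars (Exists y A) \<longrightarrow> y \<noteq> a \<and> free_for x a A)"

fun rel_symbols :: "'r form \<Rightarrow> ('r \<times> nat) set" where
  "rel_symbols (Atom r xs) = {(r, length xs)}"
| "rel_symbols Top = {}"
| "rel_symbols Bot = {}"
| "rel_symbols (And A B) = rel_symbols A \<union> rel_symbols B"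
| "rel_symbols (Or A B) = rel_symbols A \<union> rel_symbols B"
| "rel_symbols (Neg A) = rel_symbols A"
| "rel_symbols (Imp A B) = rel_symbols A \<union> rel_symbols B"
| "rel_symbols (Forall x A) = rel_symbols A"
| "rel_symbols (Exists x A) = rel_symbols A"

definition propositional :: "'r form \<Rightarrow> bool" where
  "propositional A \<longleftrightarrow> (\<forall>(r, n) \<in> rel_symbols A. n = 0)"

datatype polarity = Positive | Negative

fun opposite :: "polarity \<Rightarrow> polarity" where
  "opposite Positive = Negative"
| "opposite Negative = Positive"

(* occurs_in A s B: the formula B has a subformula occurrence of polarity s in A. *)
inductive occurs_in :: "'r form \<Rightarrow> polarity \<Rightarrow> 'r form \<Rightarrow> bool" for A where
  self: "occurs_in A Positive A"
| or1: "occurs_in A s (Or B C) \<Longrightarrow> occurs_in A s B"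
| or2: "occurs_in A s (Or B C) \<Longrightarrow> occurs_in A s C"
| and1: "occurs_in A s (And B C) \<Longrightarrow> occurs_in A s B"
| and2: "occurs_in A s (And B C) \<Longrightarrow> occurs_in A s C"
| neg: "occurs_in A s (Neg B) \<Longrightarrow> occurs_in A (opposite s) B"
| imp1: "occurs_in A s (Imp B C) \<Longrightarrow> occurs_in A (opposite s) B"
| imp2: "occurs_in A s (Imp B C) \<Longrightarrow> occurs_in A s C"
| forall: "occurs_in A s (Forall x B) \<Longrightarrow> occurs_in A s B"
| exists: "occurs_in A s (Exists x B) \<Longrightarrow> occurs_in A s B"

definition unipolar :: "'r form \<Rightarrow> bool" where
  "unipolar A \<longleftrightarrow> (\<forall>p.
     (\<forall>s. occurs_in A s (Atom p []) \<longrightarrow> s = Positive) \<or>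
     (\<forall>s. occurs_in A s (Atom p []) \<longrightarrow> s = Negative))"

datatype 'r sequent = Sequent "'r form list" "'r form option"  (infix "\<turnstile>" 50)

fun seq_forms :: "'r sequent \<Rightarrow> 'r form set" where
  "seq_forms (\<Gamma> \<turnstile> \<Lambda>) = set \<Gamma> \<union> set_option \<Lambda>"

definition not_in_seq :: "nat \<Rightarrow> 'r sequent \<Rightarrow> bool" where
  "not_in_seq a S \<longleftrightarrow> (\<forall>A \<in> seq_forms S. a \<notin> all_vars A)"

(* A calculus is a set of rule instances (premises, conclusion); axioms have no
   premises.  The rules are stated for arbitrary elements of 'r form; derivable
   below restricts derivations to sequents made of formulas. *)
type_synonym 'r calculus = "'r sequent list \<Rightarrow> 'r sequent \<Rightarrow> bool"

inductive LJ :: "'r calculus" where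
  ax: "LJ [] ([A] \<turnstile> Some A)"
| ax_top: "LJ [] ([] \<turnstile> Some Top)"
| ax_bot: "LJ [] ([Bot] \<turnstile> None)"
| thinL: "LJ [\<Gamma> \<turnstile> \<Lambda>] (A # \<Gamma> \<turnstile> \<Lambda>)"
| thinR: "LJ [\<Gamma> \<turnstile> None] (\<Gamma> \<turnstile> Some A)"
| contr: "LJ [A # A # \<Gamma> \<turnstile> \<Lambda>] (A # \<Gamma> \<turnstile> \<Lambda>)"
| exch: "LJ [\<Pi> @ A # B # \<Gamma> \<turnstile> \<Lambda>] (\<Pi> @ B # A # \<Gamma> \<turnstile> \<Lambda>)"
| cut: "LJ [\<Gamma> \<turnstile> Some C, C # \<Pi> \<turnstile> \<Lambda>] (\<Gamma> @ \<Pi> \<turnstile> \<Lambda>)"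
| andR: "LJ [\<Gamma> \<turnstile> Some A, \<Gamma> \<turnstile> Some B] (\<Gamma> \<turnstile> Some (And A B))"
| andL1: "LJ [A # \<Gamma> \<turnstile> \<Lambda>] (And A B # \<Gamma> \<turnstile> \<Lambda>)"
| andL2: "LJ [B # \<Gamma> \<turnstile> \<Lambda>] (And A B # \<Gamma> \<turnstile> \<Lambda>)"
| orL: "LJ [A # \<Gamma> \<turnstile> \<Lambda>, B # \<Gamma> \<turnstile> \<Lambda>] (Or A B # \<Gamma> \<turnstile> \<Lambda>)"
| orR1: "LJ [\<Gamma> \<turnstile> Some A] (\<Gamma> \<turnstile> Some (Or A B))"
| orR2: "LJ [\<Gamma> \<turnstile> Some B] (\<Gamma> \<turnstile> Some (Or A B))"
| negR: "LJ [A # \<Gamma> \<turnstile> None] (\<Gamma> \<turnstile> Some (Neg A))"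
| negL: "LJ [\<Gamma> \<turnstile> Some A] (Neg A # \<Gamma> \<turnstile> None)"
| impR: "LJ [A # \<Gamma> \<turnstile> Some B] (\<Gamma> \<turnstile> Some (Imp A B))"
| impL: "LJ [\<Gamma> \<turnstile> Some A, B # \<Pi> \<turnstile> \<Lambda>] (Imp A B # \<Gamma> @ \<Pi> \<turnstile> \<Lambda>)"
| forallR: "free_for x a F \<Longrightarrow> not_in_seq a (\<Gamma> \<turnstile> Some (Forall x F)) \<Longrightarrow>
    LJ [\<Gamma> \<turnstile> Some (subst x a F)] (\<Gamma> \<turnstile> Some (Forall x F))"
| forallL: "free_for x a F \<Longrightarrow>
    LJ [subst x a F # \<Gamma> \<turnstile> \<Lambda>] (Forall x F # \<Gamma> \<turnstile> \<Lambda>)"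
| existsR: "free_for x a F \<Longrightarrow>
    LJ [\<Gamma> \<turnstile> Some (subst x a F)] (\<Gamma> \<turnstile> Some (Exists x F))"
| existsL: "free_for x a F \<Longrightarrow> not_in_seq a (Exists x F # \<Gamma> \<turnstile> \<Lambda>) \<Longrightarrow>
    LJ [subst x a F # \<Gamma> \<turnstile> \<Lambda>] (Exists x F # \<Gamma> \<turnstile> \<Lambda>)"

inductive LJ_plus :: "'r calculus" where
  LJ: "LJ Ps S \<Longrightarrow> LJ_plus Ps S"
| neutralization: "propositional N \<Longrightarrow>
    LJ_plus [N # \<Gamma> \<turnstile> \<Lambda>, Neg N # \<Gamma> \<turnstile> \<Lambda>] (\<Gamma> \<turnstile> \<Lambda>)"

inductive LK :: "'r calculus" where
  LJ: "LJ Ps S \<Longrightarrow> LK Ps S"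
| excluded_middle: "LK [] ([] \<turnstile> Some (Or A (Neg A)))"

inductive derivable :: "'r calculus \<Rightarrow> 'r sequent \<Rightarrow> bool" for R where
  step: "R Ps S \<Longrightarrow> \<forall>A \<in> seq_forms S. is_formula A \<Longrightarrow>
    \<forall>P \<in> set Ps. derivable R P \<Longrightarrow> derivable R S"

definition derivable_formula :: "'r calculus \<Rightarrow> 'r form \<Rightarrow> bool" where
  "derivable_formula R A \<longleftrightarrow> derivable R ([] \<turnstile> Some A)"

end

theory Submission
  imports Defs
begin

text \<open>
  Replace every propositional symbol of a derivation by a truth constant. The rules of \<open>LJ\<close> are
  stable under this replacement (\<open>LJ_collapse\<close>), and a propositional formula \<open>N\<close> becomes a
  variable-free combination of \<open>\<top>\<close> and \<open>\<bottom>\<close>, which \<open>LJ\<close> proves or refutes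
  (\<open>collapse_decided\<close>). So each neutralization turns into a cut against a proof of the image of
  \<open>N\<close> or of its negation, and an \<open>LJ\<^sup>+\<close>-derivation of \<open>A\<close> becomes an \<open>LJ\<close>-derivation of the image
  of \<open>A\<close> (\<open>derivable_collapse\<close>).

  It remains to return from the image to \<open>A\<close>. For unipolar \<open>A\<close> the constants can be chosen so that
  each symbol is weakened or strengthened in the right direction: \<open>\<bottom>\<close> for the symbols with positive
  occurrences, \<open>\<top>\<close> for those with negative ones. As formulas are monotone in positive and
  antitone in negative positions, the image of \<open>A\<close> then implies \<open>A\<close> (\<open>entails_collapse\<close>).

  For the second part, \<open>LJ\<^sup>+\<close> is sound for Kripke models in which the propositional symbols have the
  same truth value at all worlds. Two worlds and one individual suffice to refute
  \<open>P(x) \<or> \<not> P(x)\<close>: let \<open>P\<close> hold at the upper world only.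
\<close>

section \<open>Replacing propositional symbols by truth constants\<close>

fun collapse :: "('r \<Rightarrow> bool) \<Rightarrow> 'r form \<Rightarrow> 'r form" where
  "collapse f (Atom r xs) = (if xs = [] then if f r then Top else Bot else Atom r xs)"
| "collapse f Top = Top"
| "collapse f Bot = Bot"
| "collapse f (And A B) = And (collapse f A) (collapse f B)"
| "collapse f (Or A B) = Or (collapse f A) (collapse f B)"
| "collapse f (Neg A) = Neg (collapse f A)"
| "collapse f (Imp A B) = Imp (collapse f A) (collapse f B)"
| "collapse f (Forall x A) = Forall x (collapse f A)"
| "collapse f (Exists x A) = Exists x (collapse f A)"

fun collapse_seq :: "('r \<Rightarrow> bool) \<Rightarrow> 'r sequent \<Rightarrow> 'r sequent" where
  "collapse_seq f (\<Gamma> \<turnstile> \<Lambda>) = (map (collapse f) \<Gamma> \<turnstile> map_option (collapse f) \<Lambda>)"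

lemma free_vars_collapse [simp]: "free_vars (collapse f A) = free_vars A"
  by (induction A) auto

lemma all_vars_collapse [simp]: "all_vars (collapse f A) = all_vars A"
  by (induction A) auto

lemma is_formula_collapse [simp]: "is_formula (collapse f A) = is_formula A"
  by (induction A) auto

lemma collapse_subst [simp]: "collapse f (subst x a A) = subst x a (collapse f A)"
  by (induction A) auto

lemma free_for_collapse [simp]: "free_for x a (collapse f A) = free_for x a A"
  by (induction A) auto

lemma seq_forms_collapse: "seq_forms (collapse_seq f S) = collapse f ` seq_forms S"
  by (cases S) (auto simp: image_Un option.set_map)

lemma not_in_seq_collapse: "not_in_seq a (collapse_seq f S) = not_in_seq a S"
  by (simp add: not_in_seq_def seq_forms_collapse)

lemma LJ_collapse:
  assumes "LJ Ps S"
  shows "LJ (map (collapse_seq f) Ps) (collapse_seq f S)"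
  using assms
proof cases
  case (forallR x a F \<Gamma>)
  then show ?thesis
    using not_in_seq_collapse[of a f "\<Gamma> \<turnstile> Some (Forall x F)"] by (auto intro: LJ.forallR)
next
  case (existsL x a F \<Gamma> \<Lambda>)
  then show ?thesis
    using not_in_seq_collapse[of a f "Exists x F # \<Gamma> \<turnstile> \<Lambda>"] by (auto intro: LJ.existsL)
qed (auto intro: LJ.intros)

section \<open>Derivations of images\<close>

lemma derivable_forms: "derivable R S \<Longrightarrow> A \<in> seq_forms S \<Longrightarrow> is_formula A"
  by (auto elim: derivable.cases)

text \<open>
  In derived rules the formulas of the conclusion that come from premises are known to be formulas;
  the rules below ask for \<open>is_formula\<close> only of the others.
\<close>

lemma derive0: "LJ [] S \<Longrightarrow> \<forall>A \<in> seq_forms S. is_formula A \<Longrightarrow> derivable LJ S"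
  by (rule derivable.step) auto

lemma derive1:
  assumes "LJ [P] S" "derivable LJ P" "\<forall>A \<in> seq_forms S - seq_forms P. is_formula A"
  shows "derivable LJ S"
  using assms derivable_forms[OF assms(2)] by (intro derivable.step[of LJ "[P]"]) auto

lemma derive2:
  assumes "LJ [P, Q] S" "derivable LJ P" "derivable LJ Q"
    "\<forall>A \<in> seq_forms S - seq_forms P - seq_forms Q. is_formula A"
  shows "derivable LJ S"
  using assms derivable_forms[OF assms(2)] derivable_forms[OF assms(3)]
  by (intro derivable.step[of LJ "[P, Q]"]) auto

lemma exchange:
  assumes "derivable LJ ([A, B] \<turnstile> \<Lambda>)"
  shows "derivable LJ ([B, A] \<turnstile> \<Lambda>)"
  by (rule derive1[OF LJ.exch[of "[]" A B "[]" \<Lambda>, simplified] assms]) auto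

lemma propositional_simps [simp]:
  "propositional (Atom r xs) = (xs = [])"
  "propositional (And A B) = (propositional A \<and> propositional B)"
  "propositional (Or A B) = (propositional A \<and> propositional B)"
  "propositional (Neg A) = propositional A"
  "propositional (Imp A B) = (propositional A \<and> propositional B)"
  "propositional (Forall x A) = propositional A"
  "propositional (Exists x A) = propositional A"
  by (auto simp: propositional_def)

lemma propositional_closed: "propositional A \<Longrightarrow> free_vars A = {}"
  by (induction A) auto

text \<open>
  The connectives act on provable and refutable formulas as their classical truth tables do.
  Quantifiers do not arise: their bodies would have to contain a free variable.
\<close>

lemma collapse_decided:
  assumes "is_formula N" "propositional N"
  shows "derivable LJ ([] \<turnstile> Some (collapse f N)) \<or> derivable LJ ([collapse f N] \<turnstile> None)"
  using assms
proof (induction N)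
  case (Atom r xs)
  then show ?case by (auto intro: derive0 LJ.intros)
next
  case Top
  then show ?case by (auto intro: derive0 LJ.intros)
next
  case Bot
  then show ?case by (auto intro: derive0 LJ.intros)
next
  case (And A B)
  then show ?case
    by (auto intro: derive2[OF LJ.andR] derive1[OF LJ.andL1] derive1[OF LJ.andL2])
next
  case (Or A B)
  then show ?case
    by (auto intro: derive2[OF LJ.orL] derive1[OF LJ.orR1] derive1[OF LJ.orR2])
next
  case (Neg A)
  then show ?case by (auto intro: derive1[OF LJ.negL] derive1[OF LJ.negR])
next
  case (Imp A B)
  let ?A = "collapse f A" and ?B = "collapse f B"
  have form: "is_formula ?A" "is_formula ?B" using Imp.prems by auto
  consider "derivable LJ ([] \<turnstile> Some ?B)" | "derivable LJ ([?A] \<turnstile> None)"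
    | "derivable LJ ([] \<turnstile> Some ?A)" "derivable LJ ([?B] \<turnstile> None)"
    using Imp by auto
  then show ?case
  proof cases
    case 1
    then have "derivable LJ ([?A] \<turnstile> Some ?B)"
      by (rule derive1[OF LJ.thinL]) (use form in auto)
    then have "derivable LJ ([] \<turnstile> Some (Imp ?A ?B))"
      by (rule derive1[OF LJ.impR]) (use form in auto)
    then show ?thesis by simp
  next
    case 2
    then have "derivable LJ ([?A] \<turnstile> Some ?B)"
      by (rule derive1[OF LJ.thinR]) (use form in auto)
    then have "derivable LJ ([] \<turnstile> Some (Imp ?A ?B))"
      by (rule derive1[OF LJ.impR]) (use form in auto)
    then show ?thesis by simp
  next
    case 3
    then have "derivable LJ (Imp ?A ?B # [] @ [] \<turnstile> None)"
      by (rule derive2[OF LJ.impL]) (use form in auto)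
    then show ?thesis by simp
  qed
next
  case (Forall x A)
  then show ?case by (auto dest: propositional_closed)
next
  case (Exists x A)
  then show ?case by (auto dest: propositional_closed)
qed

lemma derivable_collapse:
  assumes "derivable LJ_plus S"
  shows "derivable LJ (collapse_seq f S)"
  using assms
proof (induction rule: derivable.induct)
  case (step Ps S)
  have forms: "\<forall>A \<in> seq_forms (collapse_seq f S). is_formula A"
    using step.hyps by (auto simp: seq_forms_collapse)
  from \<open>LJ_plus Ps S\<close> show ?case
  proof cases
    case LJ
    then show ?thesis
      using forms step.IH by (intro derivable.step[of LJ "map (collapse_seq f) Ps"] LJ_collapse) auto
  next
    case (neutralization N \<Gamma> \<Lambda>)
    let ?N = "collapse f N" and ?\<Gamma> = "map (collapse f) \<Gamma>" and ?\<Lambda> = "map_option (collapse f) \<Lambda>"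
    have pos: "derivable LJ (?N # ?\<Gamma> \<turnstile> ?\<Lambda>)" and neg: "derivable LJ (Neg ?N # ?\<Gamma> \<turnstile> ?\<Lambda>)"
      using step.IH neutralization by auto
    have "is_formula N" using derivable_forms[OF pos, of ?N] by simp
    then have "derivable LJ ([] \<turnstile> Some ?N) \<or> derivable LJ ([?N] \<turnstile> None)"
      using collapse_decided \<open>propositional N\<close> by blast
    moreover have "derivable LJ ([] \<turnstile> Some (Neg ?N))" if "derivable LJ ([?N] \<turnstile> None)"
      by (rule derive1[OF LJ.negR that]) (use \<open>is_formula N\<close> in auto)
    ultimately obtain C where
      "derivable LJ ([] \<turnstile> Some C)" "derivable LJ (C # ?\<Gamma> \<turnstile> ?\<Lambda>)"
      using pos neg by blast
    then have "derivable LJ ([] @ ?\<Gamma> \<turnstile> ?\<Lambda>)"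
      by (rule derive2[OF LJ.cut]) (use forms neutralization in auto)
    then show ?thesis using neutralization by simp
  qed
qed

section \<open>Monotonicity in positive and negative positions\<close>

abbreviation entails :: "'r form \<Rightarrow> 'r form \<Rightarrow> bool" where
  "entails A B \<equiv> derivable LJ ([A] \<turnstile> Some B)"

lemma entails_forms:
  assumes "entails A B"
  shows "is_formula A" "is_formula B"
  using derivable_forms[OF assms] by auto

lemma entails_refl: "is_formula A \<Longrightarrow> entails A A"
  by (auto intro: derive0 LJ.ax)

lemma entails_And:
  assumes "entails A A'" "entails B B'"
  shows "entails (And A B) (And A' B')"
proof -
  note forms = entails_forms[OF assms(1)] entails_forms[OF assms(2)]
  have "entails (And A B) A'"
    by (rule derive1[OF LJ.andL1 assms(1)]) (use forms in auto)
  moreover have "entails (And A B) B'"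
    by (rule derive1[OF LJ.andL2 assms(2)]) (use forms in auto)
  ultimately show ?thesis by (rule derive2[OF LJ.andR]) (use forms in auto)
qed

lemma entails_Or:
  assumes "entails A A'" "entails B B'"
  shows "entails (Or A B) (Or A' B')"
proof -
  note forms = entails_forms[OF assms(1)] entails_forms[OF assms(2)]
  have "entails A (Or A' B')"
    by (rule derive1[OF LJ.orR1 assms(1)]) (use forms in auto)
  moreover have "entails B (Or A' B')"
    by (rule derive1[OF LJ.orR2 assms(2)]) (use forms in auto)
  ultimately show ?thesis by (rule derive2[OF LJ.orL]) (use forms in auto)
qed

lemma entails_Neg:
  assumes "entails A' A"
  shows "entails (Neg A) (Neg A')"
proof -
  note forms = entails_forms[OF assms]
  have "derivable LJ ([Neg A, A'] \<turnstile> None)"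
    by (rule derive1[OF LJ.negL assms]) (use forms in auto)
  then have "derivable LJ ([A', Neg A] \<turnstile> None)" by (rule exchange)
  then show ?thesis by (rule derive1[OF LJ.negR]) (use forms in auto)
qed

lemma entails_Imp:
  assumes "entails A' A" "entails B B'"
  shows "entails (Imp A B) (Imp A' B')"
proof -
  note forms = entails_forms[OF assms(1)] entails_forms[OF assms(2)]
  have "derivable LJ (Imp A B # [A'] @ [] \<turnstile> Some B')"
    by (rule derive2[OF LJ.impL assms]) (use forms in auto)
  then have "derivable LJ ([A', Imp A B] \<turnstile> Some B')"
    unfolding append.simps by (rule exchange)
  then show ?thesis by (rule derive1[OF LJ.impR]) (use forms in auto)
qed

lemma free_for_fresh: "a \<notin> all_vars A \<Longrightarrow> free_for x a A"
  by (induction A) auto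

lemma free_vars_subst_fresh:
  "a \<notin> all_vars A \<Longrightarrow>
    free_vars (subst x a A) = (if x \<in> free_vars A then insert a (free_vars A - {x}) else free_vars A)"
  by (induction A) auto

lemma is_formula_subst: "a \<notin> all_vars A \<Longrightarrow> is_formula (subst x a A) = is_formula A"
  by (induction A) (auto simp: free_vars_subst_fresh)

lemma size_subst [simp]: "size (subst x a A) = size A"
  by (induction A) auto

lemma finite_all_vars: "finite (all_vars A)"
  by (induction A) auto

lemma entails_Forall:
  assumes "entails (subst x a A) (subst x a B)" "a \<notin> all_vars A" "a \<notin> all_vars B" "a \<noteq> x"
    "is_formula (Forall x A)" "is_formula (Forall x B)"
  shows "entails (Forall x A) (Forall x B)"
proof -
  have "derivable LJ ([Forall x A] \<turnstile> Some (subst x a B))"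
    using assms entails_forms[OF assms(1)]
    by (intro derive1[OF LJ.forallL[OF free_for_fresh] assms(1)]) auto
  then show ?thesis
    by (rule derive1[OF LJ.forallR[OF free_for_fresh], rotated 2])
      (use assms in \<open>auto simp: not_in_seq_def\<close>)
qed

lemma entails_Exists:
  assumes "entails (subst x a A) (subst x a B)" "a \<notin> all_vars A" "a \<notin> all_vars B" "a \<noteq> x"
    "is_formula (Exists x A)" "is_formula (Exists x B)"
  shows "entails (Exists x A) (Exists x B)"
proof -
  have "derivable LJ ([subst x a A] \<turnstile> Some (Exists x B))"
    using assms entails_forms[OF assms(1)]
    by (intro derive1[OF LJ.existsR[OF free_for_fresh] assms(1)]) auto
  then show ?thesis
    by (rule derive1[OF LJ.existsL[OF free_for_fresh], rotated 2])
      (use assms in \<open>auto simp: not_in_seq_def\<close>)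
qed

text \<open>
  Monotonicity needs \<open>f\<close> to make propositional symbols false at positive and true at negative
  positions. This is put as a recursion on a formula in a position of polarity \<open>s\<close>, rather than
  through its occurrences in a surrounding formula, because the quantifier steps below pass to
  instances of the body, which need not occur in that formula.
\<close>

fun agrees :: "('r \<Rightarrow> bool) \<Rightarrow> polarity \<Rightarrow> 'r form \<Rightarrow> bool" where
  "agrees f s (Atom r xs) = (xs = [] \<longrightarrow> (f r \<longleftrightarrow> s = Negative))"
| "agrees f s Top = True"
| "agrees f s Bot = True"
| "agrees f s (And A B) = (agrees f s A \<and> agrees f s B)"
| "agrees f s (Or A B) = (agrees f s A \<and> agrees f s B)"
| "agrees f s (Neg A) = agrees f (opposite s) A"
| "agrees f s (Imp A B) = (agrees f (opposite s) A \<and> agrees f s B)"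
| "agrees f s (Forall x A) = agrees f s A"
| "agrees f s (Exists x A) = agrees f s A"

lemma agrees_subst: "agrees f s (subst x a A) = agrees f s A"
  by (induction A arbitrary: s) auto

lemma unipolar_agrees:
  assumes "unipolar A" "occurs_in A s B"
  shows "agrees (\<lambda>p. occurs_in A Negative (Atom p [])) s B"
  using assms(2)
proof (induction B arbitrary: s rule: form.induct)
  case (Atom r xs)
  then show ?case
    using assms(1) by (cases s) (auto simp: unipolar_def)
qed (auto intro: occurs_in.intros)

text \<open>
  Both directions are proved together, as negation and implication exchange them. The induction is
  on the size: the quantifier rules forbid the bound variable as eigenvariable, so the induction
  hypothesis is needed for the instance of the body at a fresh variable.
\<close>

lemma entails_collapse:
  "is_formula B \<Longrightarrow> (agrees f Positive B \<longrightarrow> entails (collapse f B) B) \<and>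
    (agrees f Negative B \<longrightarrow> entails B (collapse f B))"
proof (induction "size B" arbitrary: B rule: less_induct)
  case less
  have IH: "(agrees f Positive C \<longrightarrow> entails (collapse f C) C) \<and>
      (agrees f Negative C \<longrightarrow> entails C (collapse f C))"
    if "size C < size B" "is_formula C" for C
    using less.hyps that by blast
  show ?case
  proof (cases B)
    case (Atom r xs)
    have "entails Bot (Atom r xs)"
      by (rule derive1[OF LJ.thinR]) (auto intro: derive0 LJ.ax_bot)
    moreover have "entails (Atom r xs) Top"
      by (rule derive1[OF LJ.thinL]) (auto intro: derive0 LJ.ax_top)
    ultimately show ?thesis using Atom by (auto intro: entails_refl)
  next
    case (And C D)
    then show ?thesis using IH[of C] IH[of D] less.prems by (auto intro!: entails_And)
  next
    case (Or C D)
    then show ?thesis using IH[of C] IH[of D] less.prems by (auto intro!: entails_Or)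
  next
    case (Neg C)
    then show ?thesis using IH[of C] less.prems by (auto intro!: entails_Neg)
  next
    case (Imp C D)
    then show ?thesis using IH[of C] IH[of D] less.prems by (auto intro!: entails_Imp)
  next
    case (Forall x C)
    obtain a where a: "a \<notin> insert x (all_vars C)"
      using ex_new_if_finite[OF infinite_UNIV_nat, of "insert x (all_vars C)"] finite_all_vars by auto
    then show ?thesis
      using IH[of "subst x a C"] Forall less.prems
      by (auto simp: agrees_subst is_formula_subst intro!: entails_Forall[of x a])
  next
    case (Exists x C)
    obtain a where a: "a \<notin> insert x (all_vars C)"
      using ex_new_if_finite[OF infinite_UNIV_nat, of "insert x (all_vars C)"] finite_all_vars by auto
    then show ?thesis
      using IH[of "subst x a C"] Exists less.prems
      by (auto simp: agrees_subst is_formula_subst intro!: entails_Exists[of x a])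
  qed (auto intro: entails_refl)
qed

lemma unipolar_conservative:
  assumes "is_formula A" "unipolar A" "derivable_formula LJ_plus A"
  shows "derivable_formula LJ A"
proof -
  define f where "f p = occurs_in A Negative (Atom p [])" for p
  have "derivable LJ ([] \<turnstile> Some (collapse f A))"
    using derivable_collapse[of "[] \<turnstile> Some A"] assms(3) by (simp add: derivable_formula_def)
  moreover have "entails (collapse f A) A"
    using entails_collapse assms(1) unipolar_agrees[OF assms(2) occurs_in.self]
    by (auto simp: f_def[abs_def])
  ultimately have "derivable LJ ([] @ [] \<turnstile> Some A)"
    by (rule derive2[OF LJ.cut]) (use assms(1) in auto)
  then show ?thesis by (simp add: derivable_formula_def)
qed

section \<open>A Kripke model of neutralization refuting excluded middle\<close>

text \<open>
  Forcing over the worlds \<open>False \<le> True\<close>. There is only one individual, so variables need no values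
  and quantifiers are transparent. The propositional symbols are false at both worlds, and the
  predicate symbols hold at the upper world only.
\<close>

fun forces :: "bool \<Rightarrow> 'r form \<Rightarrow> bool" where
  "forces w (Atom r xs) = (xs \<noteq> [] \<and> w)"
| "forces w Top = True"
| "forces w Bot = False"
| "forces w (And A B) = (forces w A \<and> forces w B)"
| "forces w (Or A B) = (forces w A \<or> forces w B)"
| "forces w (Neg A) = (\<forall>v \<ge> w. \<not> forces v A)"
| "forces w (Imp A B) = (\<forall>v \<ge> w. forces v A \<longrightarrow> forces v B)"
| "forces w (Forall x A) = forces w A"
| "forces w (Exists x A) = forces w A"

fun forces_seq :: "bool \<Rightarrow> 'r sequent \<Rightarrow> bool" where
  "forces_seq w (\<Gamma> \<turnstile> \<Lambda>) = ((\<forall>A \<in> set \<Gamma>. forces w A) \<longrightarrow> (\<exists>A \<in> set_option \<Lambda>. forces w A))"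

lemma forces_mono: "forces w A \<Longrightarrow> w \<le> v \<Longrightarrow> forces v A"
  by (induction A) (auto dest: order_trans)

lemma forces_subst [simp]: "forces w (subst x a A) = forces w A"
  by (induction A arbitrary: w) auto

lemma forces_propositional: "propositional N \<Longrightarrow> forces w N = forces v N"
proof (induction N arbitrary: w v)
  case (Neg A)
  then have "propositional A" by simp
  then show ?case using Neg.IH by (metis forces.simps(6) order_refl)
next
  case (Imp A B)
  then have "propositional A" "propositional B" by simp_all
  then show ?case using Imp.IH by (metis forces.simps(7) order_refl)
qed auto

lemma LJ_sound:
  assumes "LJ Ps S" "\<forall>P \<in> set Ps. \<forall>w. forces_seq w P"
  shows "forces_seq w S"
  using assms
proof cases
  case (negR A \<Gamma>)
  have "\<not> forces v A" if "\<forall>C \<in> set \<Gamma>. forces w C" "w \<le> v" for v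
  proof -
    have "forces_seq v (A # \<Gamma> \<turnstile> None)" using assms(2) negR by simp
    moreover have "\<forall>C \<in> set \<Gamma>. forces v C" using that forces_mono by blast
    ultimately show ?thesis by simp
  qed
  then show ?thesis using negR by simp
next
  case (impR A \<Gamma> B)
  have "forces v B" if "\<forall>C \<in> set \<Gamma>. forces w C" "w \<le> v" "forces v A" for v
  proof -
    have "forces_seq v (A # \<Gamma> \<turnstile> Some B)" using assms(2) impR by simp
    moreover have "\<forall>C \<in> set \<Gamma>. forces v C" using that forces_mono by blast
    ultimately show ?thesis using that by simp
  qed
  then show ?thesis using impR by simp
next
  case (negL \<Gamma> A)
  then have "forces_seq w (\<Gamma> \<turnstile> Some A)" using assms(2) by simp
  then show ?thesis using negL by auto
next
  case (impL \<Gamma> A B \<Pi> \<Lambda>)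
  then have "forces_seq w (\<Gamma> \<turnstile> Some A)" "forces_seq w (B # \<Pi> \<turnstile> \<Lambda>)"
    using assms(2) by simp_all
  then show ?thesis using impL by auto
qed (use spec[OF bspec[OF assms(2)], of _ w] in auto)

lemma LJ_plus_sound: "derivable LJ_plus S \<Longrightarrow> forces_seq w S"
proof (induction arbitrary: w rule: derivable.induct)
  case (step Ps S)
  from \<open>LJ_plus Ps S\<close> show ?case
  proof cases
    case LJ
    then show ?thesis using LJ_sound step.IH by blast
  next
    case (neutralization N \<Gamma> \<Lambda>)
    have "forces w N \<or> forces w (Neg N)"
      using forces_propositional[OF \<open>propositional N\<close>] by auto
    moreover have "forces_seq w (N # \<Gamma> \<turnstile> \<Lambda>)" "forces_seq w (Neg N # \<Gamma> \<turnstile> \<Lambda>)"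
      using step.IH neutralization by simp_all
    ultimately show ?thesis using neutralization by auto
  qed
qed

lemma excluded_middle_not_LJ_plus:
  "\<not> derivable_formula LJ_plus (Or (Atom r [x]) (Neg (Atom r [x])))"
proof
  assume "derivable_formula LJ_plus (Or (Atom r [x]) (Neg (Atom r [x])))"
  then have "forces_seq False ([] \<turnstile> Some (Or (Atom r [x]) (Neg (Atom r [x]))))"
    unfolding derivable_formula_def by (rule LJ_plus_sound)
  then show False by auto
qed

theorem mainTheorem9:
  shows "(\<forall>A :: 'r form. is_formula A \<and> unipolar A \<and> derivable_formula LJ_plus A
            \<longrightarrow> derivable_formula LJ A) \<and>
         (\<exists>A :: 'r form. is_formula A \<and> derivable_formula LK A \<and>
            \<not> derivable_formula LJ_plus A)"
proof -
  define E :: "'r form" where "E = Or (Atom undefined [0]) (Neg (Atom undefined [0]))"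
  have "derivable_formula LK E"
    unfolding derivable_formula_def E_def by (rule derivable.step, rule LK.excluded_middle) simp_all
  moreover have "is_formula E" "\<not> derivable_formula LJ_plus E"
    unfolding E_def by (simp, rule excluded_middle_not_LJ_plus)
  ultimately show ?thesis using unipolar_conservative by blast
qed

end
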